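(* Let $p,q$ be complex numbers with $p\neq0$, $q\neq0$, $p^2-4q\neq0$, and let $(u_n),(v_n)$ be as in the context. Let $r,s,k$ be integers, $n$ a nonnegative integer (a positive integer for the second identity), and $z$ a complex number such that all denominators below are nonzero. Then \[ \begin{split} 2(p^2 -4q)^n\sum_{j = 0}^k u_{rj + s}^{2n} z^j =& \sum_{i = 0}^{2n} (-1)^i\binom {2n}iq^{si} \frac{q^{r(2n + ki)} v_{(rk + s)(2n - 2i)} z^{k + 2} - q^{ri(k + 1)} v_{(rk + r + s)(2n - 2i)} z^{k + 1} }{q^{2rn} z^2 - q^{ri} v_{r(2n - 2i)} z + 1}\\ &- \sum_{i = 0}^{2n} (-1)^i\binom {2n}iq^{si} \frac{q^{s(2n - 2i) + ri} v_{(r - s)(2n - 2i)} z - v_{s(2n - 2i)} }{q^{2rn} z^2 - q^{ri} v_{r(2n - 2i)} z + 1}\,, \end{split} \] \[ \begin{split} 2(p^2 -4q)^{n-1}\sum_{j = 0}^k u_{rj + s}^{2n - 1} z^j =& \sum_{i = 0}^{2n - 1} (-1)^i\binom {2n - 1}iq^{si} \frac{q^{r(2n - 1 + ki)} u_{(rk + s)(2n - 1 - 2i)} z^{k + 2} - q^{ri(k + 1)} u_{(rk + r + s)(2n - 1 - 2i)} z^{k + 1} }{q^{(2n - 1)r} z^2 - q^{ri} v_{r(2n - 1 - 2i)} z + 1}\\ &+ \sum_{i = 0}^{2n - 1} (-1)^i\binom {2n - 1}iq^{si} \frac{q^{s(2n - 1 - 2i) + ri} u_{(r - s)(2n - 1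 - 2i)} z + u_{s(2n - 1 - 2i)} }{q^{(2n - 1)r} z^2 - q^{ri} v_{r(2n - 1 - 2i)} z + 1}\,, \end{split} \] \[ \begin{split} 2\sum_{j = 0}^k v_{rj + s}^n z^j =& \sum_{i = 0}^n \binom niq^{si} \frac{q^{r(n + ki)} v_{(rk + s)(n - 2i)} z^{k + 2} - q^{ri(k + 1)} v_{(rk + r + s)(n - 2i)} z^{k + 1} }{q^{rn} z^2 - q^{ri} v_{r(n - 2i)} z + 1}\\ &- \sum_{i = 0}^n \binom niq^{si} \frac{q^{s(n - 2i) + ri} v_{(r - s)(n - 2i)} z - v_{s(n - 2i)} }{q^{rn} z^2 - q^{ri} v_{r(n - 2i)} z + 1}\,. \end{split} \]
   Context: For complex $p\neq0$, $q\neq0$, the Lucas sequences $(u_n)$ and $(v_n)$ are defined for all integers $n$ by $u_0=0,u_1=1$, $v_0=2,v_1=p$, and $x_n=px_{n-1}-qx_{n-2}$ (extended to negative indices by running the recurrence backwards). With $\alpha,\beta$ the distinct roots of $x^2-px+q$, one has $u_n=(\alpha^n-\beta^n)/(\alpha-\beta)$ and $v_n=\alpha^n+\beta^n$ for all integers $n$. *)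

theory Defs
  imports Complex_Main
begin

text \<open>
  The sequence on the integers with \<open>x\<^sub>0 = a\<close>, \<open>x\<^sub>1 = b\<close> and
  \<open>x\<^sub>n = p x\<^sub>n\<^sub>-\<^sub>1 - q x\<^sub>n\<^sub>-\<^sub>2\<close>. For negative indices the recurrence is solved for its
  lowest term, which is meaningful only for \<open>q \<noteq> 0\<close>.
\<close>

function lucas_seq :: "complex \<Rightarrow> complex \<Rightarrow> complex \<Rightarrow> complex \<Rightarrow> int \<Rightarrow> complex" where
  "lucas_seq a b p q n =
     (if n = 0 then a
      else if n = 1 then b
      else if n > 1 then p * lucas_seq a b p q (n - 1) - q * lucas_seq a b p q (n - 2)
      else (p * lucas_seq a b p q (n + 1) - lucas_seq a b p q (n + 2)) / q)"
  by auto
termination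
  by (relation "measure (\<lambda>(a, b, p, q, n). nat \<bar>2 * n - 1\<bar>)") auto

declare lucas_seq.simps [simp del]

definition lucas_u :: "complex \<Rightarrow> complex \<Rightarrow> int \<Rightarrow> complex" where
  "lucas_u p q = lucas_seq 0 1 p q"

definition lucas_v :: "complex \<Rightarrow> complex \<Rightarrow> int \<Rightarrow> complex" where
  "lucas_v p q = lucas_seq 2 p p q"

lemma lucas_seq_0: "lucas_seq a b p q 0 = a"
  by (simp add: lucas_seq.simps)

lemma lucas_seq_1: "lucas_seq a b p q 1 = b"
  by (simp add: lucas_seq.simps)

lemma lucas_seq_rec:
  assumes "q \<noteq> 0"
  shows "lucas_seq a b p q n = p * lucas_seq a b p q (n - 1) - q * lucas_seq a b p q (n - 2)"
proof (cases "n > 1")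
  case True
  then show ?thesis by (subst lucas_seq.simps) simp
next
  case False
  then have "lucas_seq a b p q (n - 2) =
      (p * lucas_seq a b p q (n - 2 + 1) - lucas_seq a b p q (n - 2 + 2)) / q"
    by (subst lucas_seq.simps) simp
  then show ?thesis using assms by simp
qed

text \<open>
  The sum of \<open>f j\<close> from \<open>j = 0\<close> to \<open>k\<close> for an arbitrary integer upper limit, with the usual
  convention that it is minus the sum over \<open>k < j < 0\<close> when \<open>k\<close> is negative. This is the reading
  compatible with telescoping; taking the sum to be \<open>0\<close> for all negative \<open>k\<close> would make closed
  forms of geometric sums fail for \<open>k < -1\<close>.
\<close>

definition sum_upto :: "(int \<Rightarrow> complex) \<Rightarrow> int \<Rightarrow> complex" where
  "sum_upto f k = (if k \<ge> 0 then \<Sum>j = 0..k. f j else - (\<Sum>j = k + 1..-1. f j))"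

lemma sum_upto_of_nat: "sum_upto f (int m) = (\<Sum>j = 0..m. f (int j))"
proof -
  have "{0..int m} = int ` {0..m}"
    by (simp add: image_int_atLeastAtMost)
  then show ?thesis
    by (simp add: sum_upto_def sum.reindex)
qed

end

theory Submission
  imports Defs
begin

text \<open>
  With \<open>\<alpha>, \<beta>\<close> the roots of \<open>x\<^sup>2 - p x + q\<close>, the binomial expansion of
  \<open>(\<alpha>\<^sup>m + \<epsilon> \<beta>\<^sup>m)\<^sup>N\<close> (\<open>\<epsilon> = \<plusminus>1\<close>), added to its reversal \<open>i \<mapsto> N - i\<close>, expresses twice the
  power through the terms \<open>q\<^sup>m\<^sup>i (\<alpha>\<^sup>M\<^sup>m + \<epsilon>\<^sup>N \<beta>\<^sup>M\<^sup>m)\<close> with \<open>M = N - 2 i\<close>. For \<open>m = r j + s\<close> each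
  of these satisfies a linear recurrence of order two in \<open>j\<close>, with characteristic coefficients
  \<open>q\<^sup>r\<^sup>i v\<^sub>r\<^sub>M\<close> and \<open>q\<^sup>r\<^sup>N\<close>, so multiplying its generating polynomial by the denominator telescopes.
\<close>

section \<open>Telescoping sums with an integer upper limit\<close>

text \<open>The sign convention for negative upper limits makes this step uniform in
  \<open>k\<close>, so that induction can run in both directions from \<open>-1\<close>, where the
  sum is empty.\<close>

lemma sum_upto_plus_one: "sum_upto f (k + 1) = sum_upto f k + f (k + 1)"
proof -
  consider "k \<ge> 0" | "k = -1" | "k < -1" by linarith
  then show ?thesis
  proof cases
    case 1
    then have "{0..k + 1} = insert (k + 1) {0..k}" by auto
    with 1 show ?thesis by (simp add: sum_upto_def)
  next
    case 2
    then show ?thesis by (simp add: sum_upto_def)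
  next
    case 3
    then have "{k + 1..-1} = insert (k + 1) {k + 1 + 1..-1}" by auto
    with 3 show ?thesis by (simp add: sum_upto_def)
  qed
qed

lemma sum_upto_minus_one: "sum_upto f (- 1) = 0"
  by (simp add: sum_upto_def)

lemma sum_upto_cmult: "sum_upto (\<lambda>j. c * f j) k = c * sum_upto f k"
  by (simp add: sum_upto_def sum_distrib_left)

lemma sum_upto_sum: "sum_upto (\<lambda>j. \<Sum>i\<in>I. f i j) k = (\<Sum>i\<in>I. sum_upto (f i) k)"
  unfolding sum_upto_def by (subst (1 2) sum.swap) (simp add: sum_negf)

text \<open>The difference of the two sides does not change from \<open>k\<close> to
  \<open>k + 1\<close> and vanishes at \<open>k = -1\<close>. For \<open>k < -1\<close> negative
  powers of \<open>z\<close> occur; at \<open>z = 0\<close> they would take the default value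
  \<open>0\<close> and break the exponent law.\<close>

lemma sum_upto_linear_recurrence:
  fixes w :: "int \<Rightarrow> complex"
  assumes rec: "\<And>j. w (j + 1) = A * w j - B * w (j - 1)"
    and z: "k < -1 \<longrightarrow> z \<noteq> 0"
  shows "(B * z^2 - A * z + 1) * sum_upto (\<lambda>j. w j * z powi j) k =
    B * w k * z powi (k + 2) - w (k + 1) * z powi (k + 1) - (B * w (-1) * z - w 0)"
    (is "?D * ?S k = ?R k")
proof -
  \<comment> \<open>For \<open>j \<ge> -1\<close> the exponents \<open>j + 2\<close> and
    \<open>j + 3\<close> are nonzero, so the powers of \<open>z\<close> split even if
    \<open>z = 0\<close>.\<close>
  have shift: "?D * ?S (j + 1) - ?R (j + 1) = ?D * ?S j - ?R j" if "z \<noteq> 0 \<or> j \<ge> -1" for j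
  proof -
    have p1: "z powi (j + 1 + 1) = z powi (j + 1) * z"
      using that power_int_add[of z "j + 1" 1] by auto
    then have p2: "z powi (j + 2) = z powi (j + 1) * z"
      by (simp add: add.assoc)
    have p3: "z powi (j + 1 + 2) = z powi (j + 1) * z^2"
      using that power_int_add[of z "j + 1" 2] by auto
    have w2: "w (j + 1 + 1) = A * w (j + 1) - B * w j"
      using rec[of "j + 1"] by simp
    show ?thesis
      unfolding sum_upto_plus_one p1 p2 p3 w2 by algebra
  qed
  \<comment> \<open>At \<open>k = -1\<close> the boundary terms \<open>B * w (-1) * z\<close> and
    \<open>w 0\<close> cancel.\<close>
  have init: "?D * ?S (-1) = ?R (-1)"
    by (simp add: sum_upto_minus_one)
  show ?thesis
  proof (cases "k \<ge> -1")
    case True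
    then show ?thesis
    proof (induction k rule: int_ge_induct)
      case base
      show ?case by (rule init)
    next
      case (step i)
      then show ?case using shift[of i] by simp
    qed
  next
    case False
    then have "z \<noteq> 0" "k \<le> -1" using z by auto
    from this(2) show ?thesis
    proof (induction k rule: int_le_induct)
      case base
      show ?case by (rule init)
    next
      case (step i)
      then show ?case using shift[of "i - 1"] \<open>z \<noteq> 0\<close> by simp
    qed
  qed
qed

section \<open>Binet formulas on the integers\<close>

text \<open>Two consecutive values determine a solution of the recurrence: downwards as well,
  because \<open>q \<noteq> 0\<close> allows solving for the lowest term. The induction therefore
  carries a pair of neighbours.\<close>

lemma lucas_seq_unique:
  assumes "q \<noteq> 0" and "f 0 = a" and "f 1 = b"
    and rec: "\<And>n. f n = p * f (n - 1) - q * f (n - 2)"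
  shows "lucas_seq a b p q n = f n"
proof -
  have "lucas_seq a b p q n = f n \<and> lucas_seq a b p q (n + 1) = f (n + 1)"
  proof (induction n rule: int_induct[where k = 0])
    case base
    show ?case using assms(2,3) by (simp add: lucas_seq_0 lucas_seq_1)
  next
    case (step1 i)
    then show ?case
      using rec[of "i + 1 + 1"] lucas_seq_rec[OF \<open>q \<noteq> 0\<close>, of a b p "i + 1 + 1"]
      by (simp add: add.commute)
  next
    case (step2 i)
    then have "q * lucas_seq a b p q (i - 1) = q * f (i - 1)"
      using rec[of "i + 1"] lucas_seq_rec[OF \<open>q \<noteq> 0\<close>, of a b p "i + 1"] by auto
    then show ?case using step2 \<open>q \<noteq> 0\<close> by simp
  qed
  then show ?thesis ..
qed

lemma power_int_quadratic_root:
  fixes x :: "'a :: field"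
  assumes "x \<noteq> 0" and "x^2 = p * x - q"
  shows "x powi n = p * x powi (n - 1) - q * x powi (n - 2)"
proof -
  have "x powi n = x powi (n - 2) * x^2" "x powi (n - 1) = x powi (n - 2) * x"
    using power_int_add[of x "n - 2" 2] power_int_add[of x "n - 2" 1] \<open>x \<noteq> 0\<close> by simp_all
  then show ?thesis using assms(2) by algebra
qed

text \<open>Powers of either root solve the recurrence, hence so do their combinations, and
  uniqueness applies. The formula for \<open>lucas_u\<close> is free of division so that it matches
  the form \<open>c * W x\<close> used for the closed forms below.\<close>

lemma binet:
  assumes "\<alpha> \<noteq> 0" "\<beta> \<noteq> 0" and p: "p = \<alpha> + \<beta>" and q: "q = \<alpha> * \<beta>"
  shows lucas_v_binet: "lucas_v p q n = \<alpha> powi n + \<beta> powi n"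
    and lucas_u_binet: "(\<alpha> - \<beta>) * lucas_u p q n = \<alpha> powi n - \<beta> powi n"
proof -
  have "q \<noteq> 0" using assms by simp
  have "\<alpha>^2 = p * \<alpha> - q" "\<beta>^2 = p * \<beta> - q"
    unfolding p q by algebra+
  then have roots: "\<alpha> powi m = p * \<alpha> powi (m - 1) - q * \<alpha> powi (m - 2)"
    "\<beta> powi m = p * \<beta> powi (m - 1) - q * \<beta> powi (m - 2)" for m
    using assms(1,2) by (blast intro: power_int_quadratic_root)+
  show "lucas_v p q n = \<alpha> powi n + \<beta> powi n"
    unfolding lucas_v_def
  proof (rule lucas_seq_unique[OF \<open>q \<noteq> 0\<close>])
    show "\<alpha> powi m + \<beta> powi m = p * (\<alpha> powi (m - 1) + \<beta> powi (m - 1)) -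
        q * (\<alpha> powi (m - 2) + \<beta> powi (m - 2))" for m
      using roots[of m] by algebra
  qed (simp_all add: p)
  show "(\<alpha> - \<beta>) * lucas_u p q n = \<alpha> powi n - \<beta> powi n"
  proof (cases "\<alpha> = \<beta>")
    case False
    have "lucas_u p q n = (\<alpha> powi n - \<beta> powi n) / (\<alpha> - \<beta>)"
      unfolding lucas_u_def
    proof (rule lucas_seq_unique[OF \<open>q \<noteq> 0\<close>])
      fix m
      have "\<alpha> powi m - \<beta> powi m = p * (\<alpha> powi (m - 1) - \<beta> powi (m - 1)) -
          q * (\<alpha> powi (m - 2) - \<beta> powi (m - 2))"
        using roots[of m] by algebra
      then show "(\<alpha> powi m - \<beta> powi m) / (\<alpha> - \<beta>) =
          p * ((\<alpha> powi (m - 1) - \<beta> powi (m - 1)) / (\<alpha> - \<beta>)) -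
          q * ((\<alpha> powi (m - 2) - \<beta> powi (m - 2)) / (\<alpha> - \<beta>))"
        by (simp only: times_divide_eq_right flip: diff_divide_distrib)
    qed (use False in simp_all)
    then show ?thesis using False by simp
  qed simp
qed

section \<open>Symmetrized binomial expansion\<close>

text \<open>Reversing the expansion turns the weight \<open>\<epsilon>^i\<close> into
  \<open>\<epsilon>^(N - i)\<close>, which is \<open>\<epsilon>^i * \<epsilon>^N\<close> because
  \<open>\<epsilon>^2 = 1\<close>. Mirror terms thus pair up with relative sign
  \<open>\<epsilon>^N\<close>.\<close>

lemma binomial_symmetrized:
  fixes a b \<epsilon> :: "'a :: comm_ring_1"
  assumes "\<epsilon>^2 = 1"
  shows "2 * (a + \<epsilon> * b)^N =
    (\<Sum>i = 0..N. \<epsilon>^i * of_nat (N choose i) * (a^(N - i) * b^i + \<epsilon>^N * (a^i * b^(N - i))))"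
proof -
  have 1: "(a + \<epsilon> * b)^N = (\<Sum>i = 0..N. \<epsilon>^i * of_nat (N choose i) * (a^(N - i) * b^i))"
    \<comment> \<open>Commuting the summands first gives \<open>\<epsilon> * b\<close> the exponent
      \<open>i\<close>; without it, as in the second expansion, \<open>a\<close> gets that exponent.
      This replaces a reindexing of the sum.\<close>
    by (subst add.commute, subst binomial_ring, unfold atMost_atLeast0)
      (intro sum.cong refl, simp add: power_mult_distrib mult_ac)
  have 2: "(a + \<epsilon> * b)^N =
      (\<Sum>i = 0..N. \<epsilon>^i * of_nat (N choose i) * (\<epsilon>^N * (a^i * b^(N - i))))"
  proof (subst binomial_ring, unfold atMost_atLeast0, intro sum.cong refl)
    fix i assume "i \<in> {0..N}"
    then have "i + N = 2 * i + (N - i)" by simp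
    then have "\<epsilon>^i * \<epsilon>^N = (\<epsilon>^2)^i * \<epsilon>^(N - i)"
      by (simp only: power_add[symmetric] power_mult[symmetric])
    then have "\<epsilon>^(N - i) = \<epsilon>^i * \<epsilon>^N"
      using assms by simp
    then show "of_nat (N choose i) * a^i * (\<epsilon> * b)^(N - i) =
        \<epsilon>^i * of_nat (N choose i) * (\<epsilon>^N * (a^i * b^(N - i)))"
      by (simp add: power_mult_distrib mult_ac)
  qed
  have "2 * (a + \<epsilon> * b)^N = (a + \<epsilon> * b)^N + (a + \<epsilon> * b)^N" by simp
  also have "\<dots> = (\<Sum>i = 0..N. \<epsilon>^i * of_nat (N choose i) * (a^(N - i) * b^i)) +
      (\<Sum>i = 0..N. \<epsilon>^i * of_nat (N choose i) * (\<epsilon>^N * (a^i * b^(N - i))))"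
    using 1 2 by simp
  finally show ?thesis by (simp add: distrib_left sum.distrib)
qed

text \<open>Both mirror terms contain \<open>(\<alpha> * \<beta>) powi (m * i)\<close>, a power of
  \<open>q\<close>. The remaining exponent is a multiple of \<open>N - 2 * i\<close>, which is
  negative for large \<open>i\<close>.\<close>

lemma binomial_symmetrized_powi:
  fixes \<alpha> \<beta> q \<epsilon> :: "'a :: field"
  assumes nz: "\<alpha> \<noteq> 0" "\<beta> \<noteq> 0" and q: "q = \<alpha> * \<beta>" and "\<epsilon>^2 = 1"
  shows "2 * (\<alpha> powi m + \<epsilon> * \<beta> powi m)^N =
    (\<Sum>i = 0..N. \<epsilon>^i * of_nat (N choose i) * (q powi (m * int i) *
      (\<alpha> powi (m * (int N - 2 * int i)) + \<epsilon>^N * \<beta> powi (m * (int N - 2 * int i)))))"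
proof (subst binomial_symmetrized[OF \<open>\<epsilon>^2 = 1\<close>], intro sum.cong refl)
  fix i assume "i \<in> {0..N}"
  then have Ni: "int (N - i) = int N - int i" by auto
  have e: "m * (int N - int i) = m * int i + m * (int N - 2 * int i)"
    by (simp add: algebra_simps)
  have "(x powi m)^i = x powi (m * int i)" for x :: 'a
    by (simp add: power_int_mult)
  moreover have "(x powi m)^(N - i) = x powi (m * int i) * x powi (m * (int N - 2 * int i))"
    if "x \<noteq> 0" for x :: 'a
  proof -
    have "(x powi m)^(N - i) = x powi (m * int (N - i))"
      by (simp only: power_int_mult power_int_of_nat)
    then show ?thesis using that by (simp only: Ni e power_int_add simp_thms)
  qed
  ultimately show "\<epsilon>^i * of_nat (N choose i) * ((\<alpha> powi m)^(N - i) * (\<beta> powi m)^i +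
        \<epsilon>^N * ((\<alpha> powi m)^i * (\<beta> powi m)^(N - i))) =
      \<epsilon>^i * of_nat (N choose i) * (q powi (m * int i) *
        (\<alpha> powi (m * (int N - 2 * int i)) + \<epsilon>^N * \<beta> powi (m * (int N - 2 * int i))))"
    using nz by (simp add: q power_int_mult_distrib algebra_simps)
qed

section \<open>Closed forms of the weighted sums\<close>

text \<open>One binomial term, for both sequences at once: \<open>W\<close> is
  \<open>lucas_v\<close> for \<open>\<epsilon> = 1\<close>, \<open>c = 1\<close>, and
  \<open>lucas_u\<close> for \<open>\<epsilon> = -1\<close>, \<open>c = \<alpha> - \<beta>\<close>.
  In \<open>j\<close> the term solves a recurrence with characteristic roots
  \<open>q powi (r * i) * \<alpha> powi (r * M)\<close> and
  \<open>q powi (r * i) * \<beta> powi (r * M)\<close>; the sum and product of these are the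
  coefficients in \<open>D\<close>.\<close>

lemma sum_upto_binet_term:
  fixes \<alpha> \<beta> q \<epsilon> c z :: complex and V W :: "int \<Rightarrow> complex" and r s k i M :: int
  assumes nz: "\<alpha> \<noteq> 0" "\<beta> \<noteq> 0" and q: "q = \<alpha> * \<beta>" and \<epsilon>: "\<epsilon>^2 = 1"
    and V: "\<And>x. V x = \<alpha> powi x + \<beta> powi x"
    and W: "\<And>x. c * W x = \<alpha> powi x + \<epsilon> * \<beta> powi x" and "c \<noteq> 0"
    and z: "k < -1 \<longrightarrow> z \<noteq> 0"
  defines "D \<equiv> q powi (r * (M + 2 * i)) * z^2 - q powi (r * i) * V (r * M) * z + 1"
  assumes D: "D \<noteq> 0"
  shows "sum_upto (\<lambda>j. q powi ((r * j + s) * i) * W ((r * j + s) * M) * z powi j) k =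
    q powi (s * i) *
      ((q powi (r * (M + 2 * i + k * i)) * W ((r * k + s) * M) * z powi (k + 2)
        - q powi (r * i * (k + 1)) * W ((r * k + r + s) * M) * z powi (k + 1)) / D)
    - q powi (s * i) *
      ((\<epsilon> * q powi (s * M + r * i) * W ((r - s) * M) * z - W (s * M)) / D)"
proof -
  have "q \<noteq> 0" using nz q by simp
  define w where "w j = q powi ((r * j + s) * i) * W ((r * j + s) * M)" for j
  let ?A = "q powi (r * i) * V (r * M)"
  let ?B = "q powi (r * (M + 2 * i))"
  have B: "?B = (q powi (r * i))^2 * (\<alpha> powi (r * M) * \<beta> powi (r * M))"
  proof -
    have "r * (M + 2 * i) = r * i + r * i + r * M" by (simp add: algebra_simps)
    then have "?B = (q powi (r * i))^2 * q powi (r * M)"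
      using \<open>q \<noteq> 0\<close> by (simp only: power_int_add power2_eq_square simp_thms)
    also have "q powi (r * M) = \<alpha> powi (r * M) * \<beta> powi (r * M)"
      by (simp add: q power_int_mult_distrib)
    finally show ?thesis .
  qed
  have rec: "w (j + 1) = ?A * w j - ?B * w (j - 1)" for j
  proof -
    \<comment> \<open>Relative to index \<open>j - 1\<close> all powers become monomials, and the
      recurrence becomes a polynomial identity.\<close>
    have shift: "x powi ((r * (j + 1) + s) * l) = x powi ((r * (j - 1) + s) * l) * (x powi (r * l))^2"
      "x powi ((r * j + s) * l) = x powi ((r * (j - 1) + s) * l) * x powi (r * l)"
      if "x \<noteq> 0" for x :: complex and l
    proof -
      have "(r * (j + 1) + s) * l = (r * (j - 1) + s) * l + (r * l + r * l)"
        "(r * j + s) * l = (r * (j - 1) + s) * l + r * l"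
        by (simp_all add: algebra_simps)
      then show "x powi ((r * (j + 1) + s) * l) = x powi ((r * (j - 1) + s) * l) * (x powi (r * l))^2"
        "x powi ((r * j + s) * l) = x powi ((r * (j - 1) + s) * l) * x powi (r * l)"
        using that by (simp_all only: power_int_add power2_eq_square simp_thms)
    qed
    have cw: "c * w m = q powi ((r * m + s) * i) *
        (\<alpha> powi ((r * m + s) * M) + \<epsilon> * \<beta> powi ((r * m + s) * M))" for m
      by (simp add: w_def flip: W)
    \<comment> \<open>Multiplication by \<open>c\<close> exposes the powers of the roots;
      \<open>c\<close> cancels afterwards.\<close>
    have "c * w (j + 1) = ?A * (c * w j) - ?B * (c * w (j - 1))"
      unfolding cw V B shift[OF nz(1)] shift[OF nz(2)] shift[OF \<open>q \<noteq> 0\<close>] by algebra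
    also have "\<dots> = c * (?A * w j - ?B * w (j - 1))" by algebra
    finally show ?thesis using \<open>c \<noteq> 0\<close> by simp
  qed
  have *: "D * sum_upto (\<lambda>j. w j * z powi j) k =
      ?B * w k * z powi (k + 2) - w (k + 1) * z powi (k + 1) - (?B * w (-1) * z - w 0)"
    unfolding D_def by (rule sum_upto_linear_recurrence[OF rec z])
  have exch: "q powi a * q powi b = q powi a' * q powi b'" if "a + b = a' + b'" for a b a' b'
    using that \<open>q \<noteq> 0\<close> by (metis power_int_add)
  have "?B * q powi ((r * k + s) * i) = q powi (s * i) * q powi (r * (M + 2 * i + k * i))"
    by (rule exch) (simp add: algebra_simps)
  then have wk: "?B * w k =
      q powi (s * i) * (q powi (r * (M + 2 * i + k * i)) * W ((r * k + s) * M))"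
    by (simp add: w_def flip: mult.assoc)
  have "(r * (k + 1) + s) * i = s * i + r * i * (k + 1)" "r * (k + 1) + s = r * k + r + s"
    by (simp_all add: algebra_simps)
  then have wk1: "w (k + 1) = q powi (s * i) * (q powi (r * i * (k + 1)) * W ((r * k + r + s) * M))"
    using \<open>q \<noteq> 0\<close> by (simp only: w_def power_int_add mult.assoc simp_thms)
  \<comment> \<open>The boundary value \<open>w (-1)\<close> has index \<open>(s - r) * M\<close>,
    while the closed form uses \<open>(r - s) * M\<close>. Negating the index costs a power of
    \<open>\<alpha> * \<beta>\<close> and the sign \<open>\<epsilon>\<close>, since it swaps the
    roots.\<close>
  have refl: "W ((s - r) * M) = \<epsilon> * q powi ((s - r) * M) * W ((r - s) * M)"
  proof -
    have "x powi ((r - s) * M) * x powi ((s - r) * M) = 1" if "x \<noteq> 0" for x :: complex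
    proof -
      have "(r - s) * M = - ((s - r) * M)" by (simp add: algebra_simps)
      then show ?thesis using that by (simp only: power_int_minus) simp
    qed
    from this[OF nz(1)] this[OF nz(2)] have "c * W ((s - r) * M) = \<epsilon> * q powi ((s - r) * M) * (c * W ((r - s) * M))"
      unfolding W q power_int_mult_distrib using \<epsilon> by algebra
    then show ?thesis using \<open>c \<noteq> 0\<close> by simp
  qed
  have "?B * w (-1) = q powi (r * (M + 2 * i)) * q powi ((s - r) * i) * q powi ((s - r) * M) *
      (\<epsilon> * W ((r - s) * M))"
    using refl by (simp add: w_def mult_ac)
  also have "q powi (r * (M + 2 * i)) * q powi ((s - r) * i) * q powi ((s - r) * M) =
      q powi (s * i) * q powi (s * M + r * i)"
    unfolding power_int_add[OF disjI1, OF \<open>q \<noteq> 0\<close>, symmetric]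
    by (rule arg_cong[where f = "power_int q"]) (simp add: algebra_simps)
  finally have wm: "?B * w (-1) =
      q powi (s * i) * (\<epsilon> * q powi (s * M + r * i) * W ((r - s) * M))"
    by (simp add: mult_ac)
  have "w 0 = q powi (s * i) * W (s * M)" by (simp add: w_def)
  then have "D * sum_upto (\<lambda>j. w j * z powi j) k = q powi (s * i) *
      (q powi (r * (M + 2 * i + k * i)) * W ((r * k + s) * M) * z powi (k + 2)
        - q powi (r * i * (k + 1)) * W ((r * k + r + s) * M) * z powi (k + 1)
        - (\<epsilon> * q powi (s * M + r * i) * W ((r - s) * M) * z - W (s * M)))"
    using * unfolding wk wk1 wm by algebra
  then have "sum_upto (\<lambda>j. w j * z powi j) k = q powi (s * i) *
      (q powi (r * (M + 2 * i + k * i)) * W ((r * k + s) * M) * z powi (k + 2)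
        - q powi (r * i * (k + 1)) * W ((r * k + r + s) * M) * z powi (k + 1)
        - (\<epsilon> * q powi (s * M + r * i) * W ((r - s) * M) * z - W (s * M))) / D"
    using D by (simp add: eq_divide_eq mult.commute)
  then show ?thesis
    unfolding w_def by (simp add: diff_divide_distrib right_diff_distrib)
qed

text \<open>Expand the power, exchange the sums and apply the closed form to each term. Two signs
  occur: \<open>\<epsilon>\<close> inside the power and \<open>\<epsilon>^N\<close> in the Binet
  form of \<open>W\<close>, so the parity of \<open>N\<close> decides which sequence appears on the
  right.\<close>

lemma sum_upto_binet_power:
  fixes \<alpha> \<beta> q \<epsilon> c z :: complex and V W :: "int \<Rightarrow> complex" and r s k :: int and N :: nat
  assumes nz: "\<alpha> \<noteq> 0" "\<beta> \<noteq> 0" and q: "q = \<alpha> * \<beta>" and \<epsilon>: "\<epsilon>^2 = 1"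
    and V: "\<And>x. V x = \<alpha> powi x + \<beta> powi x"
    and W: "\<And>x. c * W x = \<alpha> powi x + \<epsilon>^N * \<beta> powi x" and "c \<noteq> 0"
    and z: "k < -1 \<longrightarrow> z \<noteq> 0"
  defines "D \<equiv> \<lambda>i. q powi (r * int N) * z^2
    - q powi (r * int i) * V (r * (int N - 2 * int i)) * z + 1"
  assumes D: "\<forall>i\<in>{0..N}. D i \<noteq> 0"
  shows "2 * sum_upto (\<lambda>j. (\<alpha> powi (r * j + s) + \<epsilon> * \<beta> powi (r * j + s))^N * z powi j) k = c *
    ((\<Sum>i = 0..N. \<epsilon>^i * of_nat (N choose i) * q powi (s * int i) *
      ((q powi (r * (int N + k * int i)) * W ((r * k + s) * (int N - 2 * int i)) * z powi (k + 2)
        - q powi (r * int i * (k + 1)) * W ((r * k + r + s) * (int N - 2 * int i)) * z powi (k + 1))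
       / D i))
    - (\<Sum>i = 0..N. \<epsilon>^i * of_nat (N choose i) * q powi (s * int i) *
      ((\<epsilon>^N * q powi (s * (int N - 2 * int i) + r * int i) * W ((r - s) * (int N - 2 * int i)) * z
        - W (s * (int N - 2 * int i))) / D i)))"
proof -
  have \<epsilon>N: "(\<epsilon>^N)^2 = 1" using \<epsilon> by (metis power_mult mult.commute power_one)
  define b where "b i = \<epsilon>^i * of_nat (N choose i)" for i
  have "2 * sum_upto (\<lambda>j. (\<alpha> powi (r * j + s) + \<epsilon> * \<beta> powi (r * j + s))^N * z powi j) k =
      sum_upto (\<lambda>j. 2 * (\<alpha> powi (r * j + s) + \<epsilon> * \<beta> powi (r * j + s))^N * z powi j) k"
    by (simp add: sum_upto_cmult mult.assoc)
  also have "\<dots> = sum_upto (\<lambda>j. c * (\<Sum>i = 0..N. b i * (q powi ((r * j + s) * int i) *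
      W ((r * j + s) * (int N - 2 * int i)) * z powi j))) k"
    unfolding binomial_symmetrized_powi[OF nz q \<epsilon>] W[symmetric] b_def
      sum_distrib_left sum_distrib_right
    by (simp only: mult_ac)
  also have "\<dots> = c * (\<Sum>i = 0..N. b i * sum_upto (\<lambda>j. q powi ((r * j + s) * int i) *
      W ((r * j + s) * (int N - 2 * int i)) * z powi j) k)"
    by (simp only: sum_upto_sum sum_upto_cmult)
  also have "\<dots> = c * (\<Sum>i = 0..N. b i * q powi (s * int i) *
      ((q powi (r * (int N + k * int i)) * W ((r * k + s) * (int N - 2 * int i)) * z powi (k + 2)
        - q powi (r * int i * (k + 1)) * W ((r * k + r + s) * (int N - 2 * int i)) * z powi (k + 1))
       / D i)
    - b i * q powi (s * int i) *
      ((\<epsilon>^N * q powi (s * (int N - 2 * int i) + r * int i) * W ((r - s) * (int N - 2 * int i)) * z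
        - W (s * (int N - 2 * int i))) / D i))"
  proof (intro arg_cong[of _ _ "(*) c"] sum.cong refl)
    fix i assume "i \<in> {0..N}"
    then have "D i \<noteq> 0" using D by blast
    \<comment> \<open>With \<open>M = N - 2 * i\<close> the exponent \<open>M + 2 * i\<close> no
      longer depends on \<open>i\<close>.\<close>
    have N: "int N - 2 * int i + 2 * int i = int N" by simp
    show "b i * sum_upto (\<lambda>j. q powi ((r * j + s) * int i) *
        W ((r * j + s) * (int N - 2 * int i)) * z powi j) k = b i * q powi (s * int i) *
      ((q powi (r * (int N + k * int i)) * W ((r * k + s) * (int N - 2 * int i)) * z powi (k + 2)
        - q powi (r * int i * (k + 1)) * W ((r * k + r + s) * (int N - 2 * int i)) * z powi (k + 1))
       / D i)
    - b i * q powi (s * int i) *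
      ((\<epsilon>^N * q powi (s * (int N - 2 * int i) + r * int i) * W ((r - s) * (int N - 2 * int i)) * z
        - W (s * (int N - 2 * int i))) / D i)"
      using sum_upto_binet_term[OF nz q \<epsilon>N V W \<open>c \<noteq> 0\<close> z,
          of r "int N - 2 * int i" "int i" s] \<open>D i \<noteq> 0\<close>
      unfolding D_def N by (simp only: right_diff_distrib mult.assoc simp_thms)
  qed
  finally show ?thesis unfolding b_def sum_subtractf .
qed

section \<open>The three identities\<close>

text \<open>The general closed form is used with \<open>\<epsilon>\<close>, \<open>c\<close>,
  \<open>N\<close> equal to \<open>-1\<close>, \<open>1\<close>, \<open>2 * n\<close>, then
  \<open>-1\<close>, \<open>d\<close>, \<open>2 * n - 1\<close>, then \<open>1\<close>,
  \<open>1\<close>, \<open>n\<close>, where \<open>d\<close> is a square root of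
  \<open>p^2 - 4 * q\<close>. The condition on \<open>z\<close> for \<open>k < -1\<close> belongs to
  the nonvanishing of denominators, as \<open>z\<close> then has negative exponents.\<close>

theorem theorem2:
  fixes p q z :: complex and r s k :: int and n :: nat
  assumes "p \<noteq> 0" and "q \<noteq> 0" and "p^2 - 4 * q \<noteq> 0"
    and "k < -1 \<longrightarrow> z \<noteq> 0"
  shows
    "((\<forall>i\<in>{0..2*n}. q powi (2 * r * int n) * z^2
          - q powi (r * int i) * lucas_v p q (r * (2 * int n - 2 * int i)) * z + 1 \<noteq> 0) \<longrightarrow>
     2 * (p^2 - 4 * q)^n * sum_upto (\<lambda>j. lucas_u p q (r * j + s) ^ (2 * n) * z powi j) k =
       (\<Sum>i = 0..2*n. (-1)^i * of_nat ((2 * n) choose i) * q powi (s * int i) *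
          ((q powi (r * (2 * int n + k * int i))
              * lucas_v p q ((r * k + s) * (2 * int n - 2 * int i)) * z powi (k + 2)
            - q powi (r * int i * (k + 1))
              * lucas_v p q ((r * k + r + s) * (2 * int n - 2 * int i)) * z powi (k + 1))
           / (q powi (2 * r * int n) * z^2
              - q powi (r * int i) * lucas_v p q (r * (2 * int n - 2 * int i)) * z + 1)))
     - (\<Sum>i = 0..2*n. (-1)^i * of_nat ((2 * n) choose i) * q powi (s * int i) *
          ((q powi (s * (2 * int n - 2 * int i) + r * int i)
              * lucas_v p q ((r - s) * (2 * int n - 2 * int i)) * z
            - lucas_v p q (s * (2 * int n - 2 * int i)))
           / (q powi (2 * r * int n) * z^2
              - q powi (r * int i) * lucas_v p q (r * (2 * int n - 2 * int i)) * z + 1)))) \<and>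
     (n \<ge> 1 \<and>
     (\<forall>i\<in>{0..2*n-1}. q powi ((2 * int n - 1) * r) * z^2
          - q powi (r * int i) * lucas_v p q (r * (2 * int n - 1 - 2 * int i)) * z + 1 \<noteq> 0) \<longrightarrow>
     2 * (p^2 - 4 * q)^(n - 1) * sum_upto (\<lambda>j. lucas_u p q (r * j + s) ^ (2 * n - 1) * z powi j) k =
       (\<Sum>i = 0..2*n-1. (-1)^i * of_nat ((2 * n - 1) choose i) * q powi (s * int i) *
          ((q powi (r * (2 * int n - 1 + k * int i))
              * lucas_u p q ((r * k + s) * (2 * int n - 1 - 2 * int i)) * z powi (k + 2)
            - q powi (r * int i * (k + 1))
              * lucas_u p q ((r * k + r + s) * (2 * int n - 1 - 2 * int i)) * z powi (k + 1))
           / (q powi ((2 * int n - 1) * r) * z^2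
              - q powi (r * int i) * lucas_v p q (r * (2 * int n - 1 - 2 * int i)) * z + 1)))
     + (\<Sum>i = 0..2*n-1. (-1)^i * of_nat ((2 * n - 1) choose i) * q powi (s * int i) *
          ((q powi (s * (2 * int n - 1 - 2 * int i) + r * int i)
              * lucas_u p q ((r - s) * (2 * int n - 1 - 2 * int i)) * z
            + lucas_u p q (s * (2 * int n - 1 - 2 * int i)))
           / (q powi ((2 * int n - 1) * r) * z^2
              - q powi (r * int i) * lucas_v p q (r * (2 * int n - 1 - 2 * int i)) * z + 1)))) \<and>
     ((\<forall>i\<in>{0..n}. q powi (r * int n) * z^2
          - q powi (r * int i) * lucas_v p q (r * (int n - 2 * int i)) * z + 1 \<noteq> 0) \<longrightarrow>
     2 * sum_upto (\<lambda>j. lucas_v p q (r * j + s) ^ n * z powi j) k =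
       (\<Sum>i = 0..n. of_nat (n choose i) * q powi (s * int i) *
          ((q powi (r * (int n + k * int i))
              * lucas_v p q ((r * k + s) * (int n - 2 * int i)) * z powi (k + 2)
            - q powi (r * int i * (k + 1))
              * lucas_v p q ((r * k + r + s) * (int n - 2 * int i)) * z powi (k + 1))
           / (q powi (r * int n) * z^2
              - q powi (r * int i) * lucas_v p q (r * (int n - 2 * int i)) * z + 1)))
     - (\<Sum>i = 0..n. of_nat (n choose i) * q powi (s * int i) *
          ((q powi (s * (int n - 2 * int i) + r * int i)
              * lucas_v p q ((r - s) * (int n - 2 * int i)) * z
            - lucas_v p q (s * (int n - 2 * int i)))
           / (q powi (r * int n) * z^2
              - q powi (r * int i) * lucas_v p q (r * (int n - 2 * int i)) * z + 1))))"
proof -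
  define d where "d = csqrt (p^2 - 4 * q)"
  define \<alpha> \<beta> where "\<alpha> = (p + d) / 2" and "\<beta> = (p - d) / 2"
  have d2: "d^2 = p^2 - 4 * q" by (simp add: d_def)
  have pq: "p = \<alpha> + \<beta>" "q = \<alpha> * \<beta>" and d: "d = \<alpha> - \<beta>"
    using d2 by (simp_all add: \<alpha>_def \<beta>_def field_simps power2_eq_square)
  have "d \<noteq> 0" using d2 assms(3) by auto
  have nz: "\<alpha> \<noteq> 0" "\<beta> \<noteq> 0" using pq(2) assms(2) by auto
  note v = lucas_v_binet[OF nz pq]
  note u = lucas_u_binet[OF nz pq, folded d]
  note main = sum_upto_binet_power[OF nz pq(2) _ v _ _ assms(4)]
  have v': "1 * lucas_v p q x = \<alpha> powi x + 1 * \<beta> powi x" for x by (simp add: v)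
  have u': "d * lucas_u p q x = \<alpha> powi x + (-1) * \<beta> powi x" for x by (simp add: u)
  \<comment> \<open>The difference of root powers is \<open>d\<close> times \<open>lucas_u\<close>,
    and \<open>d^(2 * n)\<close> is a power of the discriminant.\<close>
  have even: "2 * sum_upto (\<lambda>j. (\<alpha> powi (r * j + s) + (-1) * \<beta> powi (r * j + s))^(2 * n) * z powi j) k
      = 2 * (p^2 - 4 * q)^n * sum_upto (\<lambda>j. lucas_u p q (r * j + s) ^ (2 * n) * z powi j) k"
    by (simp only: sum_upto_cmult u'[symmetric] power_mult_distrib power_mult d2 mult.assoc)
  \<comment> \<open>An odd power leaves one factor \<open>d\<close>, to be cancelled against
    \<open>c = d\<close>.\<close>
  have odd: "2 * sum_upto (\<lambda>j. (\<alpha> powi (r * j + s) + (-1) * \<beta> powi (r * j + s))^(2 * n - 1) * z powi j) k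
      = d * (2 * (p^2 - 4 * q)^(n - 1) *
        sum_upto (\<lambda>j. lucas_u p q (r * j + s) ^ (2 * n - 1) * z powi j) k)" if "n \<ge> 1"
  proof -
    have "2 * n - 1 = Suc (2 * (n - 1))" using that by simp
    then have "d^(2 * n - 1) = d * (p^2 - 4 * q)^(n - 1)"
      by (simp only: power_Suc power_mult d2)
    then show ?thesis
      by (simp only: sum_upto_cmult u'[symmetric] power_mult_distrib mult.assoc
          mult.left_commute[of 2 d])
  qed
  have e: "2 * r * int n = r * (2 * int n)" "(2 * int n - 1) * r = r * (2 * int n - 1)" by simp_all
  have N: "int (2 * n) = 2 * int n" by simp
  have N1: "int (2 * n - 1) = 2 * int n - 1" if "n \<ge> 1" using that by simp
  have m: "(-1 :: complex)^(2 * n) = 1" by simp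
  have m1: "(-1 :: complex)^(2 * n - 1) = -1" if "n \<ge> 1" using that by simp
  show ?thesis (is "(?D1 \<longrightarrow> ?I1) \<and> (1 \<le> n \<and> ?D2 \<longrightarrow> ?I2) \<and> (?D3 \<longrightarrow> ?I3)")
  proof (intro conjI impI)
    \<comment> \<open>Here \<open>\<epsilon>^(2 * n) = 1\<close>, so even powers of
      \<open>lucas_u\<close> are expressed through \<open>lucas_v\<close>.\<close>
    assume ?D1
    then show ?I1
      using main[of "-1" 1 "lucas_v p q" "2 * n" r s, unfolded N m, OF _ v']
      unfolding even e by simp
  next
    assume *: "1 \<le> n \<and> ?D2"
    then have "n \<ge> 1" by simp
    have cancel: "lhs = A + C" if "d * lhs = d * (A - B)" "B = - C" for lhs A B C
      using that \<open>d \<noteq> 0\<close> by simp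
    \<comment> \<open>Now \<open>\<epsilon>^N = -1\<close>: each summand of the subtracted sum is
      the negative of the stated one, which explains the plus signs in the second identity.\<close>
    have neg: "x * ((-1 * a * b * c - w) / y) = - (x * ((a * b * c + w) / y))"
      for a b c w x y :: complex
      by (simp add: diff_divide_distrib add_divide_distrib algebra_simps)
    show ?I2
      unfolding e
    proof (rule cancel[OF main[of "-1" d "lucas_u p q" "2 * n - 1" r s,
            unfolded N1[OF \<open>n \<ge> 1\<close>] m1[OF \<open>n \<ge> 1\<close>] odd[OF \<open>n \<ge> 1\<close>], OF _ u' \<open>d \<noteq> 0\<close>]])
    qed (use conjunct2[OF *] in \<open>simp_all only: neg sum_negf e power2_minus power_one\<close>)
  next
    assume ?D3
    then show ?I3
      using main[of 1 1 "lucas_v p q" n r s, unfolded power_one, OF _ v']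
      by (simp add: v)
  qed
qed

end
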